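(* Let $n=p^{a}q^{b}$, where $p$ and $q$ are distinct primes and $a,b\geq 2$ are integers. Then $$\alpha\bigl(\Theta(\mathbb{Z}_n)\bigr)=n-\min\bigl\{p^{a}q,\; pq^{b},\; p^{a}+q^{b}-1\bigr\}.$$
   Context: $\mathbb{Z}_n$ denotes the cyclic group of order $n$. For a finite group $G$, $|g|$ denotes the order of $g\in G$, and the prime-coprime graph $\Theta(G)$ is the simple graph with vertex set $G$ in which two distinct vertices $g,h$ are adjacent if and only if $\gcd(|g|,|h|)$ is either $1$ or a prime. The independence number $\alpha(\Gamma)$ of a graph $\Gamma$ is the maximum cardinality of an independent set of $\Gamma$. *)

theory Defs
  imports
    "HOL-Library.Ramsey"
    "HOL-Computational_Algebra.Primes"
    "HOL-Algebra.Multiplicative_Group"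
    "HOL-Algebra.Elementary_Groups"
begin

text \<open>
  A simple graph is a pair (V, E) of a vertex set and a set of two-element edges, so that
  \<^const>\<open>indep\<close> from the Ramsey theory applies.
\<close>

definition prime_coprime_graph :: "('a, 'b) monoid_scheme \<Rightarrow> 'a set \<times> 'a set set" where
  "prime_coprime_graph G =
    (carrier G,
     {{g, h} | g h. g \<in> carrier G \<and> h \<in> carrier G \<and> g \<noteq> h \<and>
        (gcd (group.ord G g) (group.ord G h) = 1 \<or> prime (gcd (group.ord G g) (group.ord G h)))})"

text \<open>Only meaningful when the vertex set is finite.\<close>

definition independence_number :: "'a set \<times> 'a set set \<Rightarrow> nat" where
  "independence_number \<Gamma> = Max {card S | S. S \<subseteq> fst \<Gamma> \<and> indep S (snd \<Gamma>)}"

end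

theory Submission
  imports Defs
begin

text \<open>
  Write \<open>T d\<close> for the set of elements of \<open>\<int>\<^sub>n\<close> whose order divides \<open>d\<close>; it has \<open>d\<close> elements
  if \<open>d\<close> divides \<open>n\<close>. The complements of \<open>T (p\<^sup>a q)\<close>, \<open>T (p q\<^sup>b)\<close> and \<open>T (p\<^sup>a) \<union> T (q\<^sup>b)\<close> are
  independent, because there all orders are divisible by \<open>q\<^sup>2\<close>, by \<open>p\<^sup>2\<close> and by \<open>p q\<close>, respectively.
  Conversely, an element of \<open>T (p\<^sup>a)\<close> is adjacent to every other element of \<open>T (p q\<^sup>b)\<close>, and
  symmetrically, so an independent set with at least two elements misses one of the three sets.
\<close>

text \<open>Split off the \<open>p\<close>-part of \<open>d\<close>. The cofactor is coprime to
  \<open>p\<close>, so it divides \<open>u\<close>; were the exponent of \<open>p\<close> at most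
  \<open>m\<close>, then \<open>d\<close> would divide \<open>u * p ^ m\<close>. This turns
  membership in a complement of some \<open>T\<close> into divisibility of the order by a prime
  power.\<close>

lemma prime_power_Suc_dvd:
  fixes p d u :: nat
  assumes "prime p" "d dvd u * p ^ k" "\<not> d dvd u * p ^ m"
  shows "p ^ Suc m dvd d"
proof (cases "d = 0")
  case False
  have "\<not> is_unit p" using assms(1) by auto
  then obtain e where e: "d = p ^ multiplicity p d * e" "\<not> p dvd e"
    using multiplicity_decompose'[of d p] False by blast
  have "coprime e (p ^ k)"
    using assms(1) e(2) by (metis coprime_commute coprime_power_right_iff prime_imp_coprime)
  moreover have "e dvd u * p ^ k" using e(1) assms(2) by (metis dvd_mult_right)
  ultimately have "e dvd u" by (simp add: coprime_dvd_mult_left_iff)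
  have "\<not> multiplicity p d \<le> m"
  proof
    assume "multiplicity p d \<le> m"
    then have "p ^ multiplicity p d * e dvd p ^ m * u"
      using \<open>e dvd u\<close> by (intro mult_dvd_mono le_imp_power_dvd)
    then show False using assms(3) e(1) by (simp add: mult.commute)
  qed
  then show ?thesis by (intro multiplicity_dvd') simp
qed simp

text \<open>As a divisor of \<open>p ^ a\<close>, the gcd is coprime to \<open>q ^ b\<close>, so
  only the factor \<open>p\<close> of \<open>p * q ^ b\<close> can contribute to it.\<close>

lemma gcd_dvd_prime:
  fixes p q d e :: nat
  assumes "prime p" "prime q" "p \<noteq> q" "d dvd p ^ a" "e dvd p * q ^ b"
  shows "gcd d e dvd p"
proof -
  have "coprime (p ^ a) (q ^ b)" using assms by (simp add: primes_coprime)
  then have "coprime (gcd d e) (q ^ b)"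
    using assms(4) by (meson coprime_divisors dvd_refl dvd_trans gcd_dvd1)
  moreover have "gcd d e dvd p * q ^ b" using assms(5) by (meson dvd_trans gcd_dvd2)
  ultimately show ?thesis by (simp add: coprime_dvd_mult_left_iff)
qed

lemma ord_integer_mod_group_dvd_iff:
  assumes "x \<in> carrier (integer_mod_group n)"
  shows "group.ord (integer_mod_group n) x dvd d \<longleftrightarrow> int n dvd int d * x"
  using group.pow_eq_id[OF group_integer_mod_group assms, of d]
  by (simp add: dvd_eq_mod_eq_0)

text \<open>With \<open>n = d * m\<close>, the elements counted are the multiples of
  \<open>m\<close> among the representatives 0, ..., n - 1.\<close>

lemma card_ord_dvd_integer_mod_group:
  assumes "d dvd n" "n > 0"
  shows "card {x \<in> carrier (integer_mod_group n). group.ord (integer_mod_group n) x dvd d} = d"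
proof -
  obtain m where n: "n = d * m" using assms(1) by blast
  have pos: "d > 0" "m > 0" using assms(2) n by auto
  have "{x \<in> carrier (integer_mod_group n). group.ord (integer_mod_group n) x dvd d} =
      {x. 0 \<le> x \<and> x < int n \<and> int n dvd int d * x}"
    using ord_integer_mod_group_dvd_iff assms(2)
    by (auto simp: carrier_integer_mod_group)
  also have "\<dots> = {x. 0 \<le> x \<and> x < int n \<and> int m dvd x}"
    using pos by (simp add: n)
  also have "\<dots> = (\<lambda>k. int m * k) ` {0..<int d}"
    using pos by (auto simp: n mult.commute zero_le_mult_iff elim!: dvdE)
  also have "card \<dots> = card {0..<int d}"
    using pos by (intro card_image) (auto simp: inj_on_def)
  finally show ?thesis by simp
qed

lemma card_carrier_integer_mod_group:
  "n > 0 \<Longrightarrow> card (carrier (integer_mod_group n)) = n"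
  by (simp add: carrier_integer_mod_group)

text \<open>The divisors of a prime are 1 and the prime itself, so one divisibility covers both ways
  of being adjacent.\<close>

lemma prime_coprime_graph_adjI:
  assumes "x \<in> carrier G" "y \<in> carrier G" "x \<noteq> y" "prime p"
    and "gcd (group.ord G x) (group.ord G y) dvd p"
  shows "{x, y} \<in> snd (prime_coprime_graph G)"
proof -
  have "gcd (group.ord G x) (group.ord G y) = 1 \<or> prime (gcd (group.ord G x) (group.ord G y))"
    using assms(4,5) by (metis prime_nat_iff)
  then show ?thesis using assms(1-3) unfolding prime_coprime_graph_def by auto
qed

text \<open>The gcd of two such orders inherits the divisor \<open>r * s\<close>, which divides
  neither 1 nor a prime. The case \<open>r = s\<close> is included and yields the sets where all
  orders are divisible by a prime square.\<close>

lemma indep_prime_coprime_graphI: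
  assumes "prime r" "prime s"
    and "\<And>x. x \<in> S \<Longrightarrow> r * s dvd group.ord G x"
  shows "indep S (snd (prime_coprime_graph G))"
proof -
  have "\<not> (gcd (group.ord G x) (group.ord G y) = 1 \<or> prime (gcd (group.ord G x) (group.ord G y)))"
    (is "\<not> (?g = 1 \<or> prime ?g)") if "x \<in> S" "y \<in> S" for x y
  proof -
    have "r * s dvd ?g" using assms(3) that by simp
    moreover have "\<not> r * s dvd 1" using assms(1) by auto
    moreover have False if "prime ?g"
    proof -
      have "r = ?g"
        using primes_dvd_imp_eq[OF assms(1) that] \<open>r * s dvd ?g\<close> by (meson dvd_mult_left)
      then have "r * s dvd r * 1" using \<open>r * s dvd ?g\<close> by simp
      then show False using assms(1,2) by (simp add: prime_gt_0_nat)
    qed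
    ultimately show ?thesis by metis
  qed
  then show ?thesis
    by (auto simp: indep_def prime_coprime_graph_def doubleton_eq_iff gcd.commute)
qed

lemma independence_number_eqI:
  assumes "finite (fst \<Gamma>)" "S \<subseteq> fst \<Gamma>" "indep S (snd \<Gamma>)"
    and "\<And>S'. S' \<subseteq> fst \<Gamma> \<Longrightarrow> indep S' (snd \<Gamma>) \<Longrightarrow> card S' \<le> card S"
  shows "independence_number \<Gamma> = card S"
  unfolding independence_number_def
proof (rule Max_eqI)
  have "{card S' |S'. S' \<subseteq> fst \<Gamma> \<and> indep S' (snd \<Gamma>)} \<subseteq> card ` Pow (fst \<Gamma>)" by auto
  then show "finite {card S' |S'. S' \<subseteq> fst \<Gamma> \<and> indep S' (snd \<Gamma>)}"
    using assms(1) by (meson finite_Pow_iff finite_imageI finite_subset)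
qed (use assms in auto)

lemma indep_disjoint_primary:
  assumes "prime p" "prime q" "p \<noteq> q"
    and S: "S \<subseteq> carrier G" "indep S (snd (prime_coprime_graph G))"
    and x: "x \<in> S" "group.ord G x dvd p ^ a"
    and z: "z \<in> S" "z \<noteq> x"
  shows "S \<inter> {y. group.ord G y dvd p * q ^ b} = {}"
proof -
  have nonadj: "\<not> gcd (group.ord G u) (group.ord G v) dvd p" if "u \<in> S" "v \<in> S" "u \<noteq> v" for u v
    using prime_coprime_graph_adjI[of u G v p] that S assms(1) unfolding indep_def by blast
  have "x = y" if "y \<in> S" "group.ord G y dvd p * q ^ b" for y
    using nonadj[OF x(1) that(1)] gcd_dvd_prime[OF assms(1-3) x(2) that(2)] by blast
  \<comment> \<open>Adjacency only excludes elements other than \<open>x\<close>. If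
    \<open>x\<close> itself were in the set, its order would divide \<open>p\<close>, making it
    adjacent to \<open>z\<close>.\<close>
  moreover have "\<not> group.ord G x dvd p * q ^ b"
  proof
    assume "group.ord G x dvd p * q ^ b"
    then have "group.ord G x dvd p"
      using gcd_dvd_prime[OF assms(1-3) x(2)] by fastforce
    then show False using nonadj[OF x(1) z(1)] z(2) by (metis dvd_trans gcd_dvd1)
  qed
  ultimately show ?thesis by blast
qed

theorem proposition3p15:
  fixes p q a b n :: nat
  assumes "prime p" and "prime q" and "p \<noteq> q"
    and "a \<ge> 2" and "b \<ge> 2"
    and "n = p ^ a * q ^ b"
  shows "int (independence_number (prime_coprime_graph (integer_mod_group n))) =
    int n - Min {int p ^ a * int q, int p * int q ^ b, int p ^ a + int q ^ b - 1}"
proof -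
  define G where "G = integer_mod_group n"
  define T where "T d = {x \<in> carrier G. group.ord G x dvd d}" for d
  have n0: "n > 0" using assms by (simp add: prime_gt_0_nat)
  have cop: "coprime (p ^ a) (q ^ b)" using assms by (simp add: primes_coprime)
  have pa: "p ^ a > 1" and qb: "q ^ b > 1"
    using assms prime_gt_1_nat by (auto intro!: one_less_power simp del: One_nat_def)
  have fin: "finite (carrier G)" and cardG: "card (carrier G) = n"
    using n0 by (simp_all add: G_def carrier_integer_mod_group)
  have cT: "card (T d) = d" if "d dvd n" for d
    using card_ord_dvd_integer_mod_group[OF that n0] by (simp add: T_def G_def)
  have T_sub: "T d \<subseteq> carrier G" for d by (auto simp: T_def)
  have ord_dvd: "group.ord G x dvd p ^ a * q ^ b" if "x \<in> carrier G" for x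
    using that assms(6) by (simp add: G_def ord_integer_mod_group_dvd_iff)
  have dvd_pa: "p dvd p ^ a" and dvd_qb: "q dvd q ^ b"
    using assms by (simp_all add: dvd_power)

  \<comment> \<open>The three sets, their sizes and their independent complements\<close>
  define R where "R = {T (p ^ a * q), T (p * q ^ b), T (p ^ a) \<union> T (q ^ b)}"
  have c1: "card (T (p ^ a * q)) = p ^ a * q"
    using dvd_qb assms(6) by (intro cT) (simp add: mult_dvd_mono)
  have c2: "card (T (p * q ^ b)) = p * q ^ b"
    using dvd_pa assms(6) by (intro cT) (simp add: mult_dvd_mono)
  have c3: "card (T (p ^ a) \<union> T (q ^ b)) = p ^ a + q ^ b - 1"
  proof -
    have "group.ord G x = 1" if "group.ord G x dvd p ^ a" "group.ord G x dvd q ^ b" for x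
      using that cop by (meson coprime_common_divisor_nat)
    \<comment> \<open>The two primary parts share only the identity, whence the -1 in the third
      size.\<close>
    then have "T (p ^ a) \<inter> T (q ^ b) = T 1" by (auto simp: T_def)
    then have "card (T (p ^ a) \<inter> T (q ^ b)) = 1" using cT[of 1] by simp
    moreover have "card (T (p ^ a)) = p ^ a" "card (T (q ^ b)) = q ^ b"
      using assms(6) by (auto intro: cT)
    moreover have "finite (T (p ^ a))" "finite (T (q ^ b))"
      using T_sub fin by (meson finite_subset)+
    ultimately show ?thesis using card_Un_Int[of "T (p ^ a)" "T (q ^ b)"] by simp
  qed
  have R_sub: "X \<subseteq> carrier G" if "X \<in> R" for X using that T_sub by (auto simp: R_def)
  have card_compl: "card (carrier G - X) = n - card X" if "X \<in> R" for X
    using R_sub[OF that] fin cardG by (simp add: card_Diff_subset finite_subset)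
  have indep_compl: "indep (carrier G - X) (snd (prime_coprime_graph G))" if "X \<in> R" for X
  proof -
    consider "X = T (p ^ a * q)" | "X = T (p * q ^ b)" | "X = T (p ^ a) \<union> T (q ^ b)"
      using \<open>X \<in> R\<close> by (auto simp: R_def)
    then show ?thesis
    proof cases
      case 1
      show ?thesis
      proof (rule indep_prime_coprime_graphI[OF assms(2,2)])
        fix x assume "x \<in> carrier G - X"
        \<comment> \<open>The order divides \<open>p ^ a * q ^ b\<close> but not
          \<open>p ^ a * q ^ 1\<close>, so \<open>q\<close> occurs in it at least twice. Case 2 is
          symmetric; in case 3 the excluded exponent is 0, so each prime occurs at least
          once.\<close>
        then have "q ^ Suc 1 dvd group.ord G x"
          using 1 ord_dvd by (intro prime_power_Suc_dvd[OF assms(2)]) (auto simp: T_def)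
        then show "q * q dvd group.ord G x" by simp
      qed
    next
      case 2
      show ?thesis
      proof (rule indep_prime_coprime_graphI[OF assms(1,1)])
        fix x assume "x \<in> carrier G - X"
        then have "p ^ Suc 1 dvd group.ord G x"
          using 2 ord_dvd[of x]
          by (intro prime_power_Suc_dvd[OF assms(1), of _ "q ^ b" a]) (auto simp: T_def mult.commute)
        then show "p * p dvd group.ord G x" by simp
      qed
    next
      case 3
      show ?thesis
      proof (rule indep_prime_coprime_graphI[OF assms(1,2)])
        fix x assume x: "x \<in> carrier G - X"
        have "p ^ Suc 0 dvd group.ord G x"
          using 3 x ord_dvd[of x]
          by (intro prime_power_Suc_dvd[OF assms(1), of _ "q ^ b" a]) (auto simp: T_def mult.commute)
        moreover have "q ^ Suc 0 dvd group.ord G x"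
          using 3 x ord_dvd[of x]
          by (intro prime_power_Suc_dvd[OF assms(2), of _ "p ^ a" b]) (auto simp: T_def)
        moreover have "coprime p q" using assms by (simp add: primes_coprime)
        ultimately show "p * q dvd group.ord G x" by (simp add: divides_mult)
      qed
    qed
  qed

  \<comment> \<open>Independent sets with two elements avoid one of the three sets\<close>
  have disjoint: "\<exists>X\<in>R. S \<inter> X = {}"
    if S: "S \<subseteq> carrier G" "indep S (snd (prime_coprime_graph G))" "\<not> (\<exists>x. S \<subseteq> {x})" for S
  proof -
    have two: "\<exists>z\<in>S. z \<noteq> x" for x using S(3) by blast
    consider x where "x \<in> S" "group.ord G x dvd p ^ a" | x where "x \<in> S" "group.ord G x dvd q ^ b"
      | "S \<inter> (T (p ^ a) \<union> T (q ^ b)) = {}" by (auto simp: T_def)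
    then show ?thesis
    proof cases
      case (1 x)
      obtain z where "z \<in> S" "z \<noteq> x" using two by blast
      then have "S \<inter> {y. group.ord G y dvd p * q ^ b} = {}"
        using 1 by (intro indep_disjoint_primary[OF assms(1-3) S(1,2)]) auto
      then show ?thesis by (intro bexI[of _ "T (p * q ^ b)"]) (auto simp: T_def R_def)
    next
      case (2 x)
      obtain z where "z \<in> S" "z \<noteq> x" using two by blast
      then have "S \<inter> {y. group.ord G y dvd q * p ^ a} = {}"
        using 2 by (intro indep_disjoint_primary[OF assms(2,1) assms(3)[symmetric] S(1,2)]) auto
      then show ?thesis
        by (intro bexI[of _ "T (p ^ a * q)"]) (auto simp: T_def R_def mult.commute)
    qed (auto simp: R_def)
  qed

  \<comment> \<open>The optimum: the complement of a smallest of the three sets\<close>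
  define m where "m = Min {p ^ a * q, p * q ^ b, p ^ a + q ^ b - 1}"
  have cards: "card ` R = {p ^ a * q, p * q ^ b, p ^ a + q ^ b - 1}"
    by (simp add: R_def c1 c2 c3)
  have "m \<in> card ` R" unfolding m_def cards by (rule Min_in) auto
  then obtain M where M: "M \<in> R" "card M = m" by auto
  have m_le: "m \<le> card X" if "X \<in> R" for X
    using that unfolding m_def cards[symmetric] by (intro Min_le) (auto simp: R_def)
  \<comment> \<open>Strictness makes \<open>n - m\<close> at least 1, which settles independent sets
    with at most one element. It amounts to (u + 1)(v + 1) > u + v + 1 for positive u and v.\<close>
  have "p ^ a + q ^ b - 1 < n"
  proof -
    obtain u v where uv: "p ^ a = Suc u" "q ^ b = Suc v" "u > 0" "v > 0"
      using pa qb by (metis One_nat_def Suc_lessE)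
    then show ?thesis by (simp add: assms(6))
  qed
  then have m_less: "m < n" unfolding m_def by (simp add: min_less_iff_disj)
  have "independence_number (prime_coprime_graph G) = card (carrier G - M)"
  proof (rule independence_number_eqI)
    fix S assume S: "S \<subseteq> fst (prime_coprime_graph G)" "indep S (snd (prime_coprime_graph G))"
    then have S_sub: "S \<subseteq> carrier G" by (simp add: prime_coprime_graph_def)
    have "card S \<le> n - m"
    proof (cases "\<exists>x. S \<subseteq> {x}")
      case True
      then have "card S \<le> 1" by (metis card_mono card.empty card_insert_disjoint empty_iff
            finite.emptyI finite_insert One_nat_def)
      then show ?thesis using m_less by simp
    next
      case False
      then obtain X where X: "X \<in> R" "S \<inter> X = {}" using disjoint S_sub S(2) by blast
      then have "card S \<le> card (carrier G - X)"
        using S_sub fin by (intro card_mono) auto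
      then show ?thesis using card_compl[OF X(1)] m_le[OF X(1)] by simp
    qed
    then show "card S \<le> card (carrier G - M)" using card_compl M by simp
  qed (use fin indep_compl M in \<open>auto simp: prime_coprime_graph_def\<close>)
  then have "int (independence_number (prime_coprime_graph G)) = int n - int m"
    using card_compl M m_less by simp
  \<comment> \<open>\<open>int\<close> is monotone and so commutes with \<open>Min\<close>; since
    \<open>p ^ a\<close> is positive, the subtraction of 1 on naturals is not truncated.\<close>
  moreover have "int m = Min {int p ^ a * int q, int p * int q ^ b, int p ^ a + int q ^ b - 1}"
  proof -
    have "int m = Min (int ` {p ^ a * q, p * q ^ b, p ^ a + q ^ b - 1})"
      unfolding m_def by (intro mono_Min_commute) (auto simp: mono_def)
    then show ?thesis using pa by (simp add: of_nat_diff)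
  qed
  ultimately show ?thesis by (simp add: G_def)
qed

end
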